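(* Let $\mathbf{x}_0\in\mathbb{R}^d$ be an input with ground-truth label $y_0\in[C]$. Suppose two $\beta$-smooth base models $\{F_1,F_2\}$ with confidence functions $f_1,f_2$ are both $r$-robust at $\mathbf{x}_0$. For any $\Delta\in[0,1)$: (Weighted Ensemble) Let $\mathcal{M}_{\mathrm{WE}}$ be the Weighted Ensemble over $\{F_1,F_2\}$ with weights $\{w_1,w_2\}$, and suppose $\mathcal{M}_{\mathrm{WE}}(\mathbf{x}_0)=y_0$. Put $$C_{\mathrm{WE}}=\min_{y_i:\,y_i\ne y_0}\frac{2w_1w_2f_1^{y_0/y_i}(\mathbf{x}_0)f_2^{y_0/y_i}(\mathbf{x}_0)}{\big(w_1f_1^{y_0/y_i}(\mathbf{x}_0)+w_2f_2^{y_0/y_i}(\mathbf{x}_0)\big)^2},\qquad c=\max\Big\{\tfrac{1-\Delta}{1+\Delta}\big(1-C_{\mathrm{WE}}(1-\cos\theta)\big)^{-1/2},\,1\Big\}.$$ If for every label $y_i\ne y_0$ the smoothness satisfies $\beta\le\Delta\cdot\min\{f_1^{y_0/y_i}(\mathbf{x}_0),f_2^{y_0/y_i}(\mathbf{x}_0)\}/(c^2r^2)$ and the gradient cosine similarity satisfies $\cos\langle\nabla_{\mathbf{x}} f_1^{y_0/y_i}(\mathbf{x}_0),\nabla_{\mathbf{x}} f_2^{y_0/y_i}(\mathbf{x}_0)\rangle\le\cos\theta$, then $\mathcal{M}_{\mathrm{WE}}$ is at least $R$-robust at $\mathbf{x}_0$ with $$R=r\cdot\frac{1-\Delta}{1+\Delta}\big(1-C_{\mathrm{WE}}(1-\cos\theta)\big)^{-1/2}.$$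 (Max-Margin Ensemble) Let $\mathcal{M}_{\mathrm{MME}}$ be the Max-Margin Ensemble over $\{F_1,F_2\}$, and suppose $\mathcal{M}_{\mathrm{MME}}(\mathbf{x}_0)=y_0$. Put $$C_{\mathrm{MME}}=\min_{y_1,y_2:\,y_1,y_2\ne y_0}\frac{2f_1^{y_0/y_1}(\mathbf{x}_0)f_2^{y_0/y_2}(\mathbf{x}_0)}{\big(f_1^{y_0/y_1}(\mathbf{x}_0)+f_2^{y_0/y_2}(\mathbf{x}_0)\big)^2},\qquad c=\max\Big\{\tfrac{1-\Delta}{1+\Delta}\big(1-C_{\mathrm{MME}}(1-\cos\theta)\big)^{-1/2},\,1\Big\}.$$ If for all labels $y_1\ne y_0$ and $y_2\ne y_0$ the smoothness satisfies $\beta\le\Delta\cdot\min\{f_1^{y_0/y_1}(\mathbf{x}_0),f_2^{y_0/y_2}(\mathbf{x}_0)\}/(c^2r^2)$ and $\cos\langle\nabla_{\mathbf{x}} f_1^{y_0/y_1}(\mathbf{x}_0),\nabla_{\mathbf{x}} f_2^{y_0/y_2}(\mathbf{x}_0)\rangle\le\cos\theta$, then $\mathcal{M}_{\mathrm{MME}}$ is at least $R$-robust at $\mathbf{x}_0$ with $$R=r\cdot\frac{1-\Delta}{1+\Delta}\big(1-C_{\mathrm{MME}}(1-\cos\theta)\big)^{-1/2}.$$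
   Context: Classification with $C$ classes, $[C]=\{1,\dots,C\}$. A model has a confidence function $f:\mathbb{R}^d\to\Delta^C=\{\mathbf{p}\in\mathbb{R}^C_{\ge0}:\|\mathbf{p}\|_1=1\}$, prediction $F(\mathbf{x})=\arg\max_{i\in[C]}f(\mathbf{x})_i$ and runner-up prediction $F^{(2)}(\mathbf{x})=\arg\max_{i\in[C]:i\ne F(\mathbf{x})}f(\mathbf{x})_i$ (no tie-breaking rule is specified). Confidence margin: $f^{y_1/y_2}(\mathbf{x}):=f(\mathbf{x})_{y_1}-f(\mathbf{x})_{y_2}$. $\cos\langle\mathbf{a},\mathbf{b}\rangle$ is the cosine of the angle between $\mathbf{a}$ and $\mathbf{b}$. $r$-robustness: a prediction function $F:\mathbb{R}^d\to[C]$ is $r$-robust at $\mathbf{x}_0$ if $F(\mathbf{x})=F(\mathbf{x}_0)$ for all $\mathbf{x}\in\{\mathbf{x}_0+\boldsymbol\delta:\|\boldsymbol\delta\|_2<r\}$. Weighted Ensemble with weights $w_j>0$: $\mathcal{M}_{\mathrm{WE}}(\mathbf{x}):=\arg\max_{i\in[C]}\sum_{j=1}^N w_j f_j(\mathbf{x})_i$. Max-Margin Ensemble: $\mathcal{M}_{\mathrm{MME}}(\mathbf{x}):=F_c(\mathbf{x})$ where $c=\arg\max_{i\in[N]}\big(f_i(\mathbf{x})_{F_i(\mathbf{x})}-f_i(\mathbf{x})_{F_i^{(2)}(\mathbf{x})}\big)$ (this index $c$ is unrelated to the constant $c$ in the claim). $\beta$-smoothness: a differentiable $f:\mathbb{R}^d\to\mathbb{R}^C$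 is $\beta$-smooth if $\|\nabla f(\mathbf{x}_1)_j-\nabla f(\mathbf{x}_2)_j\|_2\le\beta\|\mathbf{x}_1-\mathbf{x}_2\|_2$ for all $\mathbf{x}_1,\mathbf{x}_2\in\mathbb{R}^d$ and $j\in[C]$. A model $F$ is called $\beta$-smooth if its confidence function $f$ is $\beta$-smooth.
   Formalization: The formal theorem additionally assumes cos θ ≥ 0: for cos θ < 0 the claim as stated fails (nearly linear margins, one gradient much smaller than the other and opposite to it, make both ensembles change label inside the claimed radius R). *)

theory Defs
  imports "HOL-Analysis.Analysis"
begin

definition prob_simplex :: "(real ^ 'c) set" where
  "prob_simplex = {p. (\<forall>i. 0 \<le> p $ i) \<and> (\<Sum>i\<in>UNIV. \<bar>p $ i\<bar>) = 1}"

(* Ties: arg_max picks an unspecified maximiser, which depends only on the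
   scores being compared (and not on the input point they come from). *)
definition prediction :: "('v \<Rightarrow> real ^ 'c) \<Rightarrow> 'v \<Rightarrow> 'c" where
  "prediction f x = arg_max (\<lambda>i. f x $ i) (\<lambda>i. True)"

definition runner_up :: "('v \<Rightarrow> real ^ 'c) \<Rightarrow> 'v \<Rightarrow> 'c" where
  "runner_up f x = arg_max (\<lambda>i. f x $ i) (\<lambda>i. i \<noteq> prediction f x)"

definition margin :: "('v \<Rightarrow> real ^ 'c) \<Rightarrow> 'c \<Rightarrow> 'c \<Rightarrow> 'v \<Rightarrow> real" where
  "margin f y1 y2 x = f x $ y1 - f x $ y2"

definition robust :: "('v::real_normed_vector \<Rightarrow> 'c) \<Rightarrow> real \<Rightarrow> 'v \<Rightarrow> bool" where
  "robust F r x0 \<longleftrightarrow> (\<forall>x\<in>{x0 + \<delta> |\<delta>. norm \<delta> < r}. F x = F x0)"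

(* In the two ensembles f j, for j in {1..N}, is the confidence function of the j-th base model. *)
definition weighted_ensemble ::
    "nat \<Rightarrow> (nat \<Rightarrow> real) \<Rightarrow> (nat \<Rightarrow> 'v \<Rightarrow> real ^ 'c) \<Rightarrow> 'v \<Rightarrow> 'c" where
  "weighted_ensemble N w f x = arg_max (\<lambda>i. \<Sum>j = 1..N. w j * f j x $ i) (\<lambda>i. True)"

definition max_margin_ensemble :: "nat \<Rightarrow> (nat \<Rightarrow> 'v \<Rightarrow> real ^ 'c) \<Rightarrow> 'v \<Rightarrow> 'c" where
  "max_margin_ensemble N f x =
    prediction
      (f (arg_max (\<lambda>j. f j x $ prediction (f j) x - f j x $ runner_up (f j) x) (\<lambda>j. j \<in> {1..N})))
      x"

definition gradient :: "('v::real_inner \<Rightarrow> real) \<Rightarrow> 'v \<Rightarrow> 'v" where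
  "gradient g x = (THE D. GDERIV g x :> D)"

definition beta_smooth :: "real \<Rightarrow> (real ^ 'd \<Rightarrow> real ^ 'c) \<Rightarrow> bool" where
  "beta_smooth \<beta> f \<longleftrightarrow>
    (\<forall>x. f differentiable at x) \<and>
    (\<forall>x1 x2 j. norm (gradient (\<lambda>x. f x $ j) x1 - gradient (\<lambda>x. f x $ j) x2)
       \<le> \<beta> * norm (x1 - x2))"

(* Equals 0 when one of the vectors is 0 (the angle is undefined there). *)
definition cos_angle :: "'v::real_inner \<Rightarrow> 'v \<Rightarrow> real" where
  "cos_angle a b = inner a b / (norm a * norm b)"

definition C_WE ::
    "(nat \<Rightarrow> real) \<Rightarrow> (nat \<Rightarrow> 'v \<Rightarrow> real ^ 'c) \<Rightarrow> 'c::finite \<Rightarrow> 'v \<Rightarrow> real" where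
  "C_WE w f y0 x0 =
    (MIN y\<in>{y. y \<noteq> y0}.
       2 * w 1 * w 2 * margin (f 1) y0 y x0 * margin (f 2) y0 y x0
       / (w 1 * margin (f 1) y0 y x0 + w 2 * margin (f 2) y0 y x0)\<^sup>2)"

definition C_MME :: "(nat \<Rightarrow> 'v \<Rightarrow> real ^ 'c) \<Rightarrow> 'c::finite \<Rightarrow> 'v \<Rightarrow> real" where
  "C_MME f y0 x0 =
    (MIN (y1, y2)\<in>{(y1, y2). y1 \<noteq> y0 \<and> y2 \<noteq> y0}.
       2 * margin (f 1) y0 y1 x0 * margin (f 2) y0 y2 x0
       / (margin (f 1) y0 y1 x0 + margin (f 2) y0 y2 x0)\<^sup>2)"

end

theory Submission
  imports Defs
begin

text \<open>
  If \<open>\<beta> = 0\<close>, the confidence functions are affine and bounded, hence constant. Otherwise the bound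
  on \<open>\<beta>\<close> forces \<open>\<Delta>\<close> and all margins at \<open>x0\<close> to be positive, so both base models predict \<open>y0\<close>.
  Margins have \<open>2 * \<beta>\<close>-Lipschitz gradients, so they differ from their linearisation by at most
  \<open>\<beta> * (norm \<delta>)\<^sup>2\<close>. Moving against the gradient of a base margin up to distance \<open>r\<close> keeps it
  nonnegative, whence its norm is at most \<open>(1 + \<Delta>) / r\<close> times the margin. By the cosine bound,
  the gradient of the combined margin \<open>M\<close> has norm at most \<open>(1 + \<Delta>) / r * M * sqrt (1 - C * (1 - cos \<theta>))\<close>,
  and the Taylor lower bound is positive up to the claimed radius.
\<close>

section \<open>Maximisers over finite sets and the decisions of the ensembles\<close>

text \<open>\<open>arg_max\<close> is a choice operator, so it returns a genuine maximiser only
  where one exists; finiteness and the witness \<open>k\<close> provide one.\<close>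

lemma arg_max_finite:
  fixes s :: "'a \<Rightarrow> 'b::linorder"
  assumes "finite {i. P i}" "P k"
  shows "P (arg_max s P)" "s k \<le> s (arg_max s P)"
proof -
  have "Max (s ` {i. P i}) \<in> s ` {i. P i}"
    using assms by (intro Max_in) auto
  then obtain m where m: "P m" "s m = Max (s ` {i. P i})" by auto
  then have le: "s i \<le> s m" if "P i" for i
    using that assms by simp
  have "P (arg_max s P) \<and> (\<forall>i. P i \<longrightarrow> s i \<le> s (arg_max s P))"
    by (rule arg_maxI[where x = m]) (use m le in \<open>auto simp: not_less intro: order_trans\<close>)
  then show "P (arg_max s P)" "s k \<le> s (arg_max s P)"
    using assms by auto
qed

text \<open>A strict maximum leaves no room for the unspecified tie-breaking.\<close>

lemma arg_max_strict:
  fixes s :: "'a::finite \<Rightarrow> 'b::linorder"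
  assumes "\<And>i. i \<noteq> k \<Longrightarrow> s i < s k"
  shows "arg_max s (\<lambda>i. True) = k"
  using arg_max_finite(2)[of "\<lambda>i. True" k s] assms by force

lemma confidence_le_prediction:
  fixes f :: "'v \<Rightarrow> real ^ 'c"
  shows "f x $ y \<le> f x $ prediction f x"
  unfolding prediction_def by (rule arg_max_finite) auto

lemma prediction_eqI:
  fixes f :: "'v \<Rightarrow> real ^ 'c"
  assumes "\<And>y. y \<noteq> y0 \<Longrightarrow> 0 < margin f y0 y x"
  shows "prediction f x = y0"
  unfolding prediction_def
  by (rule arg_max_strict) (use assms in \<open>auto simp: margin_def\<close>)

lemma runner_up:
  fixes f :: "'v \<Rightarrow> real ^ 'c"
  assumes "y \<noteq> prediction f x"
  shows "runner_up f x \<noteq> prediction f x" "f x $ y \<le> f x $ runner_up f x"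
  unfolding runner_up_def
  using arg_max_finite[of "\<lambda>i. i \<noteq> prediction f x" y "\<lambda>i. f x $ i"] assms by simp_all

lemma weighted_ensemble_2_eqI:
  fixes f :: "nat \<Rightarrow> 'v \<Rightarrow> real ^ 'c"
  assumes "\<And>y. y \<noteq> y0 \<Longrightarrow> 0 < w 1 * margin (f 1) y0 y x + w 2 * margin (f 2) y0 y x"
  shows "weighted_ensemble 2 w f x = y0"
  unfolding weighted_ensemble_def
  by (rule arg_max_strict)
     (use assms in \<open>simp add: margin_def algebra_simps numeral_2_eq_2\<close>)

text \<open>A model that mispredicts has margin at most minus its margin for \<open>y0\<close>; the other model then
  predicts \<open>y0\<close> with a larger margin, and is the one chosen.\<close>

lemma max_margin_ensemble_2_eqI:
  fixes f :: "nat \<Rightarrow> 'v \<Rightarrow> real ^ 'c"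
  assumes pos: "\<And>y1 y2. y1 \<noteq> y0 \<Longrightarrow> y2 \<noteq> y0 \<Longrightarrow>
    0 < margin (f 1) y0 y1 x + margin (f 2) y0 y2 x"
  shows "max_margin_ensemble 2 f x = y0"
proof (rule ccontr)
  define gap where "gap j = f j x $ prediction (f j) x - f j x $ runner_up (f j) x" for j
  define j where "j = arg_max gap (\<lambda>j. j \<in> {1..2})"
  assume "max_margin_ensemble 2 f x \<noteq> y0"
  then have mis: "prediction (f j) x \<noteq> y0"
    unfolding max_margin_ensemble_def j_def gap_def[abs_def] by simp
  have j: "j \<in> {1..2}" "\<And>k. k \<in> {1..2} \<Longrightarrow> gap k \<le> gap j"
    unfolding j_def
    using arg_max_finite(1)[of "\<lambda>j. j \<in> {1..2::nat}" 1 gap]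
      arg_max_finite(2)[of "\<lambda>j. j \<in> {1..2::nat}" _ gap] by simp_all
  define k where "k = 3 - j"
  have jk: "j = 1 \<and> k = 2 \<or> j = 2 \<and> k = 1"
    using j(1) unfolding k_def by auto
  have pos': "0 < margin (f j) y0 y x + margin (f k) y0 y' x" if "y \<noteq> y0" "y' \<noteq> y0" for y y'
    using jk pos[of y y'] pos[of y' y] that by auto
  \<comment> \<open>As \<open>y0\<close> is not predicted by model \<open>j\<close>, it competes for
    runner-up and bounds the runner-up confidence from below.\<close>
  have gap_j: "gap j \<le> - margin (f j) y0 (prediction (f j) x) x"
    using runner_up(2)[of y0 "f j" x] mis unfolding gap_def margin_def by auto
  have less: "gap j < margin (f k) y0 y x" if "y \<noteq> y0" for y
    using gap_j pos'[OF mis that] by simp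
  have "0 \<le> gap j"
    unfolding gap_def using confidence_le_prediction[of "f j" x] by simp
  then have pred: "prediction (f k) x = y0"
    using less by (intro prediction_eqI) (meson order.strict_trans1)
  have "runner_up (f k) x \<noteq> y0"
    using runner_up(1)[of "prediction (f j) x" "f k" x] mis pred by auto
  then have "gap j < gap k"
    using less pred unfolding gap_def[of k] margin_def by auto
  then show False
    using j(2)[of k] jk by auto
qed

section \<open>Gradients and second-order Taylor bounds\<close>

text \<open>\<open>gradient\<close> is a definite description, so its value rests on uniqueness.
  Both vectors represent the same functional; evaluating it at \<open>D - E\<close> gives squared
  norm zero.\<close>

lemma GDERIV_unique:
  assumes "GDERIV g x :> D" "GDERIV g x :> E"
  shows "D = E"
proof -
  have "(\<lambda>h. inner h D) = (\<lambda>h. inner h E)"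
    using assms unfolding gderiv_def by (rule has_derivative_unique)
  then have "inner (D - E) D = inner (D - E) E" by meson
  then show ?thesis
    by (metis eq_iff_diff_eq_0 inner_diff_right inner_eq_zero_iff)
qed

lemma gradient_eqI:
  assumes "GDERIV g x :> D"
  shows "gradient g x = D"
  unfolding gradient_def using assms GDERIV_unique by blast

text \<open>Riesz representation in coordinates: the gradient collects the values of the derivative
  on the basis.\<close>

lemma GDERIV_gradient:
  fixes g :: "'a::euclidean_space \<Rightarrow> real"
  assumes "g differentiable (at x)"
  shows "GDERIV g x :> gradient g x"
proof -
  obtain g' where g': "(g has_derivative g') (at x)"
    using assms unfolding differentiable_def by blast
  have "g' h = inner h (\<Sum>b\<in>Basis. g' b *\<^sub>R b)" for h
  proof -
    have "g' h = g' (\<Sum>b\<in>Basis. inner h b *\<^sub>R b)"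
      by (simp add: euclidean_representation)
    also have "\<dots> = (\<Sum>b\<in>Basis. inner h b * g' b)"
      using has_derivative_linear[OF g'] by (simp add: linear_sum linear_cmul)
    finally show ?thesis
      by (simp add: inner_sum_right mult.commute)
  qed
  then have "GDERIV g x :> (\<Sum>b\<in>Basis. g' b *\<^sub>R b)"
    unfolding gderiv_def using g' by (metis (no_types, lifting) ext)
  then show ?thesis
    using gradient_eqI by metis
qed

text \<open>The descent lemma. In place of an integral along the segment, the defect
  \<open>\<phi>\<close> is shown to be nonincreasing: Cauchy-Schwarz and the Lipschitz bound make
  its derivative nonpositive.\<close>

lemma lipschitz_gradient_upper:
  fixes g :: "'a::real_inner \<Rightarrow> real"
  assumes g: "\<And>x. GDERIV g x :> D x"
    and lip: "\<And>x y. norm (D x - D y) \<le> L * norm (x - y)"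
  shows "g (x + \<delta>) \<le> g x + inner (D x) \<delta> + L / 2 * (norm \<delta>)\<^sup>2"
proof -
  define \<phi> where "\<phi> t = g (x + t *\<^sub>R \<delta>) - t * inner (D x) \<delta> - L / 2 * t\<^sup>2 * (norm \<delta>)\<^sup>2" for t
  have "\<phi> 1 \<le> \<phi> 0"
  proof (rule DERIV_nonpos_imp_nonincreasing[where f = \<phi>])
    fix t :: real assume t: "0 \<le> t" "t \<le> 1"
    have "((\<lambda>t. x + t *\<^sub>R \<delta>) has_derivative (\<lambda>h. h *\<^sub>R \<delta>)) (at t)"
      by (auto intro!: derivative_eq_intros)
    moreover have "(g has_derivative (\<lambda>h. inner h (D (x + t *\<^sub>R \<delta>)))) (at (x + t *\<^sub>R \<delta>))"
      using g by (simp add: gderiv_def)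
    ultimately have "((\<lambda>t. g (x + t *\<^sub>R \<delta>)) has_derivative
        (\<lambda>h. inner (h *\<^sub>R \<delta>) (D (x + t *\<^sub>R \<delta>)))) (at t)"
      by (rule has_derivative_compose)
    then have "((\<lambda>t. g (x + t *\<^sub>R \<delta>)) has_real_derivative inner (D (x + t *\<^sub>R \<delta>)) \<delta>) (at t)"
      by (simp add: has_field_derivative_def inner_commute mult.commute[of _ "inner _ _"])
    then have "(\<phi> has_real_derivative
        inner (D (x + t *\<^sub>R \<delta>)) \<delta> - inner (D x) \<delta> - L * t * (norm \<delta>)\<^sup>2) (at t)"
      unfolding \<phi>_def by (auto intro!: derivative_eq_intros)
    moreover have "inner (D (x + t *\<^sub>R \<delta>)) \<delta> - inner (D x) \<delta> \<le> L * t * (norm \<delta>)\<^sup>2"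
    proof -
      have "inner (D (x + t *\<^sub>R \<delta>)) \<delta> - inner (D x) \<delta> \<le> norm (D (x + t *\<^sub>R \<delta>) - D x) * norm \<delta>"
        using norm_cauchy_schwarz by (simp flip: inner_diff_left)
      also have "\<dots> \<le> L * norm (x + t *\<^sub>R \<delta> - x) * norm \<delta>"
        by (intro mult_right_mono lip) auto
      finally show ?thesis
        using t by (simp add: power2_eq_square)
    qed
    ultimately show "\<exists>y. (\<phi> has_real_derivative y) (at t) \<and> y \<le> 0"
      by force
  qed simp
  then show ?thesis
    by (simp add: \<phi>_def)
qed

text \<open>The lower bound is the descent lemma for the negated function.\<close>

lemma lipschitz_gradient_taylor:
  fixes g :: "'a::real_inner \<Rightarrow> real"
  assumes g: "\<And>x. GDERIV g x :> D x"
    and lip: "\<And>x y. norm (D x - D y) \<le> L * norm (x - y)"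
  shows "\<bar>g (x + \<delta>) - g x - inner (D x) \<delta>\<bar> \<le> L / 2 * (norm \<delta>)\<^sup>2"
proof -
  have "- g (x + \<delta>) \<le> - g x + inner (- D x) \<delta> + L / 2 * (norm \<delta>)\<^sup>2"
  proof (rule lipschitz_gradient_upper)
    show "GDERIV (\<lambda>x. - g x) x :> - D x" for x
      using g by (rule GDERIV_minus)
    show "norm (- D x - - D y) \<le> L * norm (x - y)" for x y
      using lip[of x y] by (simp add: norm_minus_commute)
  qed
  then show ?thesis
    using lipschitz_gradient_upper[OF assms, of x \<delta>] by (simp only: inner_minus_left)
qed

section \<open>Smooth confidence functions, their margins and gradient norms\<close>

lemma beta_smooth_component:
  assumes "beta_smooth \<beta> f"
  shows "GDERIV (\<lambda>x. f x $ i) x :> gradient (\<lambda>x. f x $ i) x"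
    and "norm (gradient (\<lambda>x. f x $ i) x - gradient (\<lambda>x. f x $ i) y) \<le> \<beta> * norm (x - y)"
proof -
  have "f differentiable (at x)"
    using assms by (simp add: beta_smooth_def)
  then have "(\<lambda>x. f x $ i) differentiable (at x)"
    unfolding differentiable_def
    using bounded_linear.has_derivative[OF bounded_linear_vec_nth] by blast
  then show "GDERIV (\<lambda>x. f x $ i) x :> gradient (\<lambda>x. f x $ i) x"
    by (rule GDERIV_gradient)
  show "norm (gradient (\<lambda>x. f x $ i) x - gradient (\<lambda>x. f x $ i) y) \<le> \<beta> * norm (x - y)"
    using assms by (simp add: beta_smooth_def)
qed

lemma beta_smooth_nonneg:
  fixes f :: "real ^ 'd \<Rightarrow> real ^ 'c"
  assumes "beta_smooth \<beta> f"
  shows "0 \<le> \<beta>"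
proof -
  \<comment> \<open>A vector of norm 1, so that the Lipschitz bound reads off the sign of
    \<beta>.\<close>
  have "0 \<le> \<beta> * norm (axis undefined 1 - 0 :: real ^ 'd)"
    using beta_smooth_component(2)[OF assms] norm_ge_zero order_trans by blast
  then show ?thesis by simp
qed

text \<open>The Taylor remainder vanishes, and a nonconstant affine coordinate would leave the
  interval from 0 to 1.\<close>

lemma beta_smooth_zero_const:
  assumes smooth: "beta_smooth 0 f" and simplex: "\<And>x. f x \<in> prob_simplex"
  shows "f x = f y"
proof -
  have "f x $ i = f y $ i" for i
  proof -
    define D where "D = gradient (\<lambda>x. f x $ i)"
    have le1: "f z $ i \<le> 1" for z
      using simplex[of z] member_le_sum[of i UNIV "\<lambda>i. \<bar>f z $ i\<bar>"]
      by (auto simp: prob_simplex_def)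
    have ge0: "0 \<le> f z $ i" for z
      using simplex[of z] by (auto simp: prob_simplex_def)
    have affine: "f (y + \<delta>) $ i = f y $ i + inner (D y) \<delta>" for \<delta>
      using lipschitz_gradient_taylor[OF beta_smooth_component[OF smooth, of i], of y \<delta>]
      by (simp add: D_def)
    have "D y = 0"
    proof (rule ccontr)
      assume "D y \<noteq> 0"
      \<comment> \<open>This displacement raises the coordinate by exactly 2.\<close>
      then show False
        using affine[of "(2 / inner (D y) (D y)) *\<^sub>R D y"] ge0[of y]
          le1[of "y + (2 / inner (D y) (D y)) *\<^sub>R D y"] by simp
    qed
    then show ?thesis
      using affine[of "x - y"] by simp
  qed
  then show ?thesis
    by (simp add: vec_eq_iff)
qed

text \<open>The Lipschitz constants of the two components add up to \<open>2 * \<beta>\<close>, and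
  the factor 1/2 of the remainder cancels the 2.\<close>

lemma beta_smooth_margin_taylor:
  assumes "beta_smooth \<beta> f"
  shows "\<bar>margin f y0 y (x + \<delta>) - margin f y0 y x - inner (gradient (margin f y0 y) x) \<delta>\<bar>
    \<le> \<beta> * (norm \<delta>)\<^sup>2"
proof -
  define D where "D i = gradient (\<lambda>x. f x $ i)" for i
  note comp = beta_smooth_component[OF assms, folded D_def]
  have deriv: "GDERIV (margin f y0 y) x :> D y0 x - D y x" for x
    unfolding margin_def[abs_def] by (intro GDERIV_diff comp)
  have lip: "norm ((D y0 x - D y x) - (D y0 z - D y z)) \<le> 2 * \<beta> * norm (x - z)" for x z
    using norm_triangle_ineq4[of "D y0 x - D y0 z" "D y x - D y z"]
      comp(2)[of y0 x z] comp(2)[of y x z] by (simp add: algebra_simps)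
  show ?thesis
    using lipschitz_gradient_taylor[OF deriv lip] gradient_eqI[OF deriv] by simp
qed

text \<open>Compare the Taylor upper bound with nonnegativity at \<open>x0 - t *\<^sub>R D / norm D\<close> and let
  \<open>t\<close> tend to \<open>r\<close> from below.\<close>

lemma gradient_norm_bound:
  fixes g :: "'a::real_inner \<Rightarrow> real"
  assumes upper: "\<And>\<delta>. g (x0 + \<delta>) \<le> g x0 + inner D \<delta> + \<beta> * (norm \<delta>)\<^sup>2"
    and nonneg: "\<And>\<delta>. norm \<delta> < r \<Longrightarrow> 0 \<le> g (x0 + \<delta>)"
    and r: "0 < r" and beta: "0 \<le> \<beta>"
  shows "r * norm D \<le> g x0 + \<beta> * r\<^sup>2"
proof (cases "D = 0")
  case True
  then show ?thesis
    using nonneg[of 0] r beta by simp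
next
  case False
  have "0 \<le> g x0 - t * norm D + \<beta> * t\<^sup>2" if "0 < t" "t < r" for t
  proof -
    define \<delta> where "\<delta> = - (t / norm D) *\<^sub>R D"
    have "norm \<delta> = t" "inner D \<delta> = - t * norm D"
      using that False by (auto simp: \<delta>_def dot_square_norm power2_eq_square)
    then show ?thesis
      using nonneg[of \<delta>] upper[of \<delta>] that by simp
  qed
  moreover have "((\<lambda>t. g x0 - t * norm D + \<beta> * t\<^sup>2) \<longlongrightarrow> g x0 - r * norm D + \<beta> * r\<^sup>2) (at_left r)"
    by (intro tendsto_intros)
  ultimately have "0 \<le> g x0 - r * norm D + \<beta> * r\<^sup>2"
    using r by (intro tendsto_lowerbound[where F = "at_left r"])
      (auto simp: eventually_at_left intro!: exI[of _ 0])
  then show ?thesis by simp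
qed

section \<open>Positivity of a weighted sum of two margins\<close>

text \<open>The common core of both ensembles, with \<open>k\<close> for the cosine bound.
  \<open>C\<close> is only bounded by the ratio of the two margins at hand, because the ensemble
  constants are minima over labels.\<close>

lemma combined_margin_pos:
  fixes g1 g2 :: "'a::real_inner \<Rightarrow> real"
  assumes taylor1: "\<And>\<delta>. \<bar>g1 (x0 + \<delta>) - g1 x0 - inner D1 \<delta>\<bar> \<le> \<beta> * (norm \<delta>)\<^sup>2"
    and taylor2: "\<And>\<delta>. \<bar>g2 (x0 + \<delta>) - g2 x0 - inner D2 \<delta>\<bar> \<le> \<beta> * (norm \<delta>)\<^sup>2"
    and nonneg1: "\<And>\<delta>. norm \<delta> < r \<Longrightarrow> 0 \<le> g1 (x0 + \<delta>)"
    and nonneg2: "\<And>\<delta>. norm \<delta> < r \<Longrightarrow> 0 \<le> g2 (x0 + \<delta>)"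
    and r: "0 < r" and beta: "0 \<le> \<beta>" and w: "0 < w1" "0 < w2"
    and Delta: "0 < \<Delta>" "\<Delta> < 1"
    and m: "0 < g1 x0" "0 < g2 x0"
    and k: "0 \<le> k" "k \<le> 1" "cos_angle D1 D2 \<le> k"
    and C: "C \<le> 2 * w1 * w2 * g1 x0 * g2 x0 / (w1 * g1 x0 + w2 * g2 x0)\<^sup>2"
    and \<kappa>: "\<kappa> = (1 - \<Delta>) / (1 + \<Delta>) * (1 - C * (1 - k)) powr (-1/2)"
    and c: "c = max \<kappa> 1"
    and beta_le: "\<beta> \<le> \<Delta> * min (g1 x0) (g2 x0) / (c\<^sup>2 * r\<^sup>2)"
    and \<delta>: "norm \<delta> < r * \<kappa>"
  shows "0 < w1 * g1 (x0 + \<delta>) + w2 * g2 (x0 + \<delta>)"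
proof -
  define a where "a = w1 * g1 x0"
  define b where "b = w2 * g2 x0"
  define M where "M = a + b"
  define s where "s = 1 - C * (1 - k)"
  define G where "G = w1 *\<^sub>R D1 + w2 *\<^sub>R D2"
  have ab: "0 < a" "0 < b" "0 < M"
    using w m by (auto simp: a_def b_def M_def add_pos_pos)
  have C': "C * M\<^sup>2 \<le> 2 * a * b"
    using C ab by (simp add: a_def b_def M_def field_simps)
  \<comment> \<open>By the AM-GM inequality \<open>C\<close> is at most 1/2, so \<open>s\<close> is
    at least \<open>(1 + k) / 2\<close> and its inverse square root makes sense.\<close>
  have "4 * (a * b) \<le> M\<^sup>2"
    using zero_le_power2[of "a - b"] by (simp add: M_def power2_eq_square algebra_simps)
  then have "C * M\<^sup>2 \<le> 1 / 2 * M\<^sup>2"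
    using C' by simp
  then have "C \<le> 1 / 2"
    using ab by (simp add: mult_le_cancel_right)
  then have "C * (1 - k) \<le> 1 / 2 * (1 - k)"
    using k by (intro mult_right_mono) auto
  then have s: "0 < s"
    using k by (simp add: s_def)
  have \<kappa>': "\<kappa> * sqrt s = (1 - \<Delta>) / (1 + \<Delta>)"
    using s by (simp add: \<kappa> powr_minus powr_half_sqrt flip: s_def)
  \<comment> \<open>The two bounds on \<open>c\<close> serve different radii:
    \<open>1 \<le> c\<close> controls the remainder up to \<open>r\<close>, for the gradient norms,
    and \<open>\<kappa> \<le> c\<close> controls it up to \<open>r * \<kappa>\<close>.\<close>
  have c1: "1 \<le> c" "\<kappa> \<le> c"
    by (auto simp: c)
  then have c2r2: "r\<^sup>2 \<le> c\<^sup>2 * r\<^sup>2" "0 < c\<^sup>2 * r\<^sup>2"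
    using r by (auto simp: one_le_power)
  have beta_m: "\<beta> * (c\<^sup>2 * r\<^sup>2) \<le> \<Delta> * g1 x0" "\<beta> * (c\<^sup>2 * r\<^sup>2) \<le> \<Delta> * g2 x0"
  proof -
    have "\<beta> * (c\<^sup>2 * r\<^sup>2) \<le> \<Delta> * min (g1 x0) (g2 x0)"
      using beta_le c2r2 by (simp add: pos_le_divide_eq)
    moreover have "\<Delta> * min (g1 x0) (g2 x0) \<le> \<Delta> * g1 x0" "\<Delta> * min (g1 x0) (g2 x0) \<le> \<Delta> * g2 x0"
      using Delta by auto
    ultimately show "\<beta> * (c\<^sup>2 * r\<^sup>2) \<le> \<Delta> * g1 x0" "\<beta> * (c\<^sup>2 * r\<^sup>2) \<le> \<Delta> * g2 x0"
      by linarith+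
  qed
  have "\<beta> * r\<^sup>2 \<le> \<beta> * (c\<^sup>2 * r\<^sup>2)"
    using c2r2 beta by (intro mult_left_mono)
  moreover have "r * norm D1 \<le> g1 x0 + \<beta> * r\<^sup>2"
  proof (rule gradient_norm_bound)
    show "g1 (x0 + \<delta>) \<le> g1 x0 + inner D1 \<delta> + \<beta> * (norm \<delta>)\<^sup>2" for \<delta>
      using taylor1[of \<delta>] by linarith
  qed (use nonneg1 r beta in auto)
  moreover have "r * norm D2 \<le> g2 x0 + \<beta> * r\<^sup>2"
  proof (rule gradient_norm_bound)
    show "g2 (x0 + \<delta>) \<le> g2 x0 + inner D2 \<delta> + \<beta> * (norm \<delta>)\<^sup>2" for \<delta>
      using taylor2[of \<delta>] by linarith
  qed (use nonneg2 r beta in auto)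
  ultimately have "r * norm D1 \<le> (1 + \<Delta>) * g1 x0" "r * norm D2 \<le> (1 + \<Delta>) * g2 x0"
    using beta_m by (simp_all add: algebra_simps)
  then have "w1 * (r * norm D1) \<le> w1 * ((1 + \<Delta>) * g1 x0)"
    "w2 * (r * norm D2) \<le> w2 * ((1 + \<Delta>) * g2 x0)"
    using w by auto
  then have n: "r * (w1 * norm D1) \<le> (1 + \<Delta>) * a" "r * (w2 * norm D2) \<le> (1 + \<Delta>) * b"
    by (simp_all add: a_def b_def algebra_simps)
  define p where "p = r * (w1 * norm D1)"
  define q where "q = r * (w2 * norm D2)"
  have pq: "0 \<le> p" "0 \<le> q" "p \<le> (1 + \<Delta>) * a" "q \<le> (1 + \<Delta>) * b"
    using n w r by (auto simp: p_def q_def)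
  \<comment> \<open>If a gradient vanishes, the value of \<open>cos_angle\<close> carries no
    information, but both sides are 0.\<close>
  have "inner D1 D2 \<le> norm D1 * norm D2 * k"
    using k by (cases "D1 = 0 \<or> D2 = 0") (auto simp: cos_angle_def field_simps)
  then have inner_le: "r\<^sup>2 * (w1 * w2) * inner D1 D2 \<le> r\<^sup>2 * (w1 * w2) * (norm D1 * norm D2 * k)"
    using w by (intro mult_left_mono) auto
  have "(r * norm G)\<^sup>2 = p\<^sup>2 + q\<^sup>2 + 2 * (r\<^sup>2 * (w1 * w2) * inner D1 D2)"
    unfolding G_def p_def q_def power_mult_distrib power2_norm_eq_inner
    by (simp add: inner_add_left inner_add_right inner_commute algebra_simps power2_eq_square)
  also have "\<dots> \<le> p\<^sup>2 + q\<^sup>2 + 2 * (p * q * k)"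
    using inner_le by (simp add: p_def q_def power2_eq_square algebra_simps)
  \<comment> \<open>Since \<open>k\<close> is nonnegative, the cross term is monotone in
    \<open>p\<close> and \<open>q\<close>.\<close>
  also have "\<dots> \<le> ((1 + \<Delta>) * a)\<^sup>2 + ((1 + \<Delta>) * b)\<^sup>2 + 2 * (((1 + \<Delta>) * a) * ((1 + \<Delta>) * b) * k)"
    using pq k ab Delta
    by (intro add_mono mult_left_mono mult_right_mono mult_mono power_mono) auto
  also have "\<dots> = (1 + \<Delta>)\<^sup>2 * (M\<^sup>2 - 2 * a * b * (1 - k))"
    by (simp add: M_def power2_eq_square algebra_simps)
  \<comment> \<open>The product \<open>2 * a * b\<close> enters with the factor
    \<open>- (1 - k)\<close>, so its lower bound \<open>C * M\<^sup>2\<close> gives an upper bound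
    here.\<close>
  also have "\<dots> \<le> (1 + \<Delta>)\<^sup>2 * (M\<^sup>2 - C * M\<^sup>2 * (1 - k))"
    using C' k by (intro mult_left_mono diff_left_mono mult_right_mono) auto
  also have "\<dots> = (1 + \<Delta>)\<^sup>2 * M\<^sup>2 * s"
    by (simp add: s_def algebra_simps)
  also have "\<dots> = ((1 + \<Delta>) * M * sqrt s)\<^sup>2"
    using s by (simp add: power_mult_distrib)
  finally have "(r * norm G)\<^sup>2 \<le> ((1 + \<Delta>) * M * sqrt s)\<^sup>2" .
  then have norm_G: "r * norm G \<le> (1 + \<Delta>) * M * sqrt s"
    by (rule power2_le_imp_le) (use ab Delta s in auto)
  have "0 < \<kappa>"
    using \<delta> r by (metis norm_ge_zero order.strict_trans1 zero_less_mult_pos)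
  \<comment> \<open>The radius is chosen so that \<open>\<kappa> * sqrt s\<close> turns the factor
    \<open>1 + \<Delta>\<close> into \<open>1 - \<Delta>\<close>.\<close>
  have "r * (norm G * norm \<delta>) \<le> r * norm G * (r * \<kappa>)"
    using \<delta> r mult_left_mono[of "norm \<delta>" "r * \<kappa>" "r * norm G"] by simp
  also have "\<dots> \<le> (1 + \<Delta>) * M * sqrt s * (r * \<kappa>)"
    using norm_G \<open>0 < \<kappa>\<close> r by (intro mult_right_mono) auto
  also have "\<dots> = r * ((1 + \<Delta>) * M * (\<kappa> * sqrt s))"
    by simp
  also have "\<dots> = r * ((1 - \<Delta>) * M)"
    unfolding \<kappa>' using Delta by simp
  finally have lin: "norm G * norm \<delta> \<le> (1 - \<Delta>) * M"
    using r by simp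
  \<comment> \<open>The linear term may consume all of \<open>(1 - \<Delta>) * M\<close>, so
    strictness has to come from the remainder: from \<open>norm \<delta> < r * c\<close> if \<beta>
    is positive, and from \<open>0 < \<Delta> * M\<close> if it is 0.\<close>
  have quad: "(w1 + w2) * (\<beta> * (norm \<delta>)\<^sup>2) < \<Delta> * M"
  proof -
    have "w1 * (\<beta> * (c\<^sup>2 * r\<^sup>2)) + w2 * (\<beta> * (c\<^sup>2 * r\<^sup>2)) \<le> w1 * (\<Delta> * g1 x0) + w2 * (\<Delta> * g2 x0)"
      using w by (intro add_mono mult_left_mono beta_m) auto
    then have "(w1 + w2) * (\<beta> * (c\<^sup>2 * r\<^sup>2)) \<le> \<Delta> * M"
      by (simp add: M_def a_def b_def algebra_simps)
    moreover have "norm \<delta> < r * c"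
      using \<delta> c1 r by (meson less_le_trans mult_left_mono less_imp_le)
    then have "(norm \<delta>)\<^sup>2 < c\<^sup>2 * r\<^sup>2"
      using power_strict_mono[of "norm \<delta>" "r * c" 2] by (simp add: power_mult_distrib mult.commute)
    then have "(w1 + w2) * (\<beta> * (norm \<delta>)\<^sup>2) < (w1 + w2) * (\<beta> * (c\<^sup>2 * r\<^sup>2))" if "0 < \<beta>"
      using that w by simp
    moreover have "0 < \<Delta> * M"
      using Delta ab by simp
    ultimately show ?thesis
      using beta by (cases "\<beta> = 0") auto
  qed
  have "w1 * (g1 x0 + inner D1 \<delta> - \<beta> * (norm \<delta>)\<^sup>2) \<le> w1 * g1 (x0 + \<delta>)"
    "w2 * (g2 x0 + inner D2 \<delta> - \<beta> * (norm \<delta>)\<^sup>2) \<le> w2 * g2 (x0 + \<delta>)"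
    using taylor1[of \<delta>] taylor2[of \<delta>] w by auto
  then have "M + inner G \<delta> - (w1 + w2) * (\<beta> * (norm \<delta>)\<^sup>2) \<le> w1 * g1 (x0 + \<delta>) + w2 * g2 (x0 + \<delta>)"
    by (simp add: M_def a_def b_def G_def inner_add_left algebra_simps)
  moreover have "- (norm G * norm \<delta>) \<le> inner G \<delta>"
    using Cauchy_Schwarz_ineq2[of G \<delta>] by linarith
  ultimately show ?thesis
    using lin quad by (simp add: algebra_simps)
qed

section \<open>From base margins to robustness of the ensembles\<close>

text \<open>This turns the smoothness hypothesis into positive margins at \<open>x0\<close>, so that
  both base models predict \<open>y0\<close> although only the ensemble is assumed to do so.\<close>

lemma smoothness_bound_pos:
  fixes \<beta> \<Delta> a b d :: real
  assumes "0 < \<beta>" "0 \<le> \<Delta>" "0 \<le> d" "\<beta> \<le> \<Delta> * min a b / d"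
  shows "0 < \<Delta>" "0 < a" "0 < b"
proof -
  have "0 < \<Delta> * min a b / d"
    using assms by linarith
  then have "0 < \<Delta> * min a b"
    using assms(3) by (simp add: zero_less_divide_iff)
  then show "0 < \<Delta>" "0 < a" "0 < b"
    using assms(2) by (auto simp: zero_less_mult_iff)
qed

lemma robustI:
  assumes "\<And>\<delta>. norm \<delta> < r \<Longrightarrow> F (x0 + \<delta>) = F x0"
  shows "robust F r x0"
  using assms by (auto simp: robust_def)

text \<open>Robustness fixes only the prediction at the perturbed point; a maximiser may be tied
  there, so the margin is merely nonnegative.\<close>

lemma robust_margin_nonneg:
  fixes f :: "'v::real_normed_vector \<Rightarrow> real ^ 'c"
  assumes "robust (prediction f) r x0" "norm \<delta> < r"
    and "\<And>y. y \<noteq> y0 \<Longrightarrow> 0 < margin f y0 y x0"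
  shows "0 \<le> margin f y0 y (x0 + \<delta>)"
proof -
  have "prediction f (x0 + \<delta>) = prediction f x0"
    using assms unfolding robust_def by blast
  also have "\<dots> = y0"
    using assms(3) by (rule prediction_eqI)
  finally show ?thesis
    using confidence_le_prediction[of f "x0 + \<delta>" y] by (simp add: margin_def)
qed

text \<open>Equal scores lead \<open>arg_max\<close> to the same choice even under ties, whatever
  the radius.\<close>

lemma robust_weighted_ensemble_const:
  fixes f :: "nat \<Rightarrow> 'v::real_normed_vector \<Rightarrow> real ^ 'c"
  assumes "\<And>j x y. j \<in> {1, 2} \<Longrightarrow> f j x = f j y"
  shows "robust (weighted_ensemble 2 w f) R x0"
proof (rule robustI)
  fix \<delta>
  have "f 1 (x0 + \<delta>) = f 1 x0" "f 2 (x0 + \<delta>) = f 2 x0" using assms by blast+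
  then show "weighted_ensemble 2 w f (x0 + \<delta>) = weighted_ensemble 2 w f x0"
    by (simp add: weighted_ensemble_def numeral_2_eq_2)
qed

lemma robust_max_margin_ensemble_const:
  fixes f :: "nat \<Rightarrow> 'v::real_normed_vector \<Rightarrow> real ^ 'c"
  assumes "\<And>j x y. j \<in> {1, 2} \<Longrightarrow> f j x = f j y"
  shows "robust (max_margin_ensemble 2 f) R x0"
proof (rule robustI)
  fix \<delta>
  define gap where "gap x j = f j x $ prediction (f j) x - f j x $ runner_up (f j) x" for x j
  have eq: "f j (x0 + \<delta>) = f j x0" if "j \<in> {1..2}" for j
    using assms[of j] that by (metis atLeastAtMost_iff insertCI le_antisym not_less_eq_eq one_add_one plus_1_eq_Suc)
  have pred: "prediction (f j) (x0 + \<delta>) = prediction (f j) x0" if "j \<in> {1..2}" for j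
    using eq[OF that] by (simp add: prediction_def)
  have "gap (x0 + \<delta>) j = gap x0 j" if "j \<in> {1..2}" for j
    using eq[OF that] pred[OF that] by (simp add: gap_def runner_up_def)
  \<comment> \<open>The gap functions may differ at indices outside \<open>{1..2}\<close>, but they
    have the same maximisers within it, so the choice operator returns the same index.\<close>
  then have "is_arg_max (gap (x0 + \<delta>)) (\<lambda>j. j \<in> {1..2}) = is_arg_max (gap x0) (\<lambda>j. j \<in> {1..2})"
    by (auto simp: is_arg_max_def fun_eq_iff)
  then have "arg_max (gap (x0 + \<delta>)) (\<lambda>j. j \<in> {1..2}) = arg_max (gap x0) (\<lambda>j. j \<in> {1..2})"
    by (simp add: arg_max_def)
  moreover have "arg_max (gap x0) (\<lambda>j. j \<in> {1..2}) \<in> {1..2}"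
    using arg_max_finite(1)[of "\<lambda>j. j \<in> {1..2::nat}" 1] by simp
  ultimately show "max_margin_ensemble 2 f (x0 + \<delta>) = max_margin_ensemble 2 f x0"
    using pred unfolding max_margin_ensemble_def gap_def[abs_def] by simp
qed

text \<open>For each rival label \<open>y\<close>, \<open>combined_margin_pos\<close> applies to the
  two margins against \<open>y\<close> with the ensemble weights.\<close>

lemma robust_weighted_ensemble:
  fixes f :: "nat \<Rightarrow> real ^ 'd \<Rightarrow> real ^ 'c"
  assumes smooth: "\<And>j. j \<in> {1, 2} \<Longrightarrow> beta_smooth \<beta> (f j)"
    and r: "0 < r" and beta: "0 < \<beta>"
    and base_robust: "\<And>j. j \<in> {1, 2} \<Longrightarrow> robust (prediction (f j)) r x0"
    and Delta: "0 \<le> \<Delta>" "\<Delta> < 1"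
    and k: "0 \<le> k" "k \<le> 1"
    and \<kappa>: "\<kappa> = (1 - \<Delta>) / (1 + \<Delta>) * (1 - C_WE w f y0 x0 * (1 - k)) powr (-1/2)"
    and c: "c = max \<kappa> 1"
    and w: "0 < w 1" "0 < w 2"
    and pred0: "weighted_ensemble 2 w f x0 = y0"
    and beta_le: "\<And>y. y \<noteq> y0 \<Longrightarrow>
      \<beta> \<le> \<Delta> * min (margin (f 1) y0 y x0) (margin (f 2) y0 y x0) / (c\<^sup>2 * r\<^sup>2)"
    and cos_le: "\<And>y. y \<noteq> y0 \<Longrightarrow>
      cos_angle (gradient (margin (f 1) y0 y) x0) (gradient (margin (f 2) y0 y) x0) \<le> k"
  shows "robust (weighted_ensemble 2 w f) (r * \<kappa>) x0"
proof (rule robustI)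
  fix \<delta> :: "real ^ 'd" assume \<delta>: "norm \<delta> < r * \<kappa>"
  have pos: "0 < \<Delta>" "0 < margin (f 1) y0 y x0" "0 < margin (f 2) y0 y x0" if "y \<noteq> y0" for y
    using smoothness_bound_pos[OF beta Delta(1) _ beta_le[OF that]] by auto
  have "weighted_ensemble 2 w f (x0 + \<delta>) = y0"
  proof (rule weighted_ensemble_2_eqI)
    fix y assume y: "y \<noteq> y0"
    show "0 < w 1 * margin (f 1) y0 y (x0 + \<delta>) + w 2 * margin (f 2) y0 y (x0 + \<delta>)"
    proof (rule combined_margin_pos[OF beta_smooth_margin_taylor[OF smooth] beta_smooth_margin_taylor[OF smooth]])
      show "C_WE w f y0 x0 \<le> 2 * w 1 * w 2 * margin (f 1) y0 y x0 * margin (f 2) y0 y x0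
          / (w 1 * margin (f 1) y0 y x0 + w 2 * margin (f 2) y0 y x0)\<^sup>2"
        unfolding C_WE_def using y by (intro Min_le) auto
      show "0 \<le> margin (f 1) y0 y (x0 + \<delta>)" "0 \<le> margin (f 2) y0 y (x0 + \<delta>)"
        if "norm \<delta> < r" for \<delta>
        using base_robust pos(2,3) that by (auto intro: robust_margin_nonneg)
    qed (use y pos smooth r beta Delta k \<kappa> c w beta_le cos_le \<delta> in auto)
  qed
  then show "weighted_ensemble 2 w f (x0 + \<delta>) = weighted_ensemble 2 w f x0"
    using pred0 by simp
qed

text \<open>The two models may have different rivals, so positivity is shown for every pair
  \<open>y1\<close>, \<open>y2\<close>; hence the hypotheses and \<open>C_MME\<close> range over
  pairs.\<close>

lemma robust_max_margin_ensemble: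
  fixes f :: "nat \<Rightarrow> real ^ 'd \<Rightarrow> real ^ 'c"
  assumes smooth: "\<And>j. j \<in> {1, 2} \<Longrightarrow> beta_smooth \<beta> (f j)"
    and r: "0 < r" and beta: "0 < \<beta>"
    and base_robust: "\<And>j. j \<in> {1, 2} \<Longrightarrow> robust (prediction (f j)) r x0"
    and Delta: "0 \<le> \<Delta>" "\<Delta> < 1"
    and k: "0 \<le> k" "k \<le> 1"
    and \<kappa>: "\<kappa> = (1 - \<Delta>) / (1 + \<Delta>) * (1 - C_MME f y0 x0 * (1 - k)) powr (-1/2)"
    and c: "c = max \<kappa> 1"
    and pred0: "max_margin_ensemble 2 f x0 = y0"
    and beta_le: "\<And>y1 y2. y1 \<noteq> y0 \<Longrightarrow> y2 \<noteq> y0 \<Longrightarrow>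
      \<beta> \<le> \<Delta> * min (margin (f 1) y0 y1 x0) (margin (f 2) y0 y2 x0) / (c\<^sup>2 * r\<^sup>2)"
    and cos_le: "\<And>y1 y2. y1 \<noteq> y0 \<Longrightarrow> y2 \<noteq> y0 \<Longrightarrow>
      cos_angle (gradient (margin (f 1) y0 y1) x0) (gradient (margin (f 2) y0 y2) x0) \<le> k"
  shows "robust (max_margin_ensemble 2 f) (r * \<kappa>) x0"
proof (rule robustI)
  fix \<delta> :: "real ^ 'd" assume \<delta>: "norm \<delta> < r * \<kappa>"
  \<comment> \<open>The diagonal pair \<open>y\<close>, \<open>y\<close> already yields both
    margins.\<close>
  have pos: "0 < \<Delta>" "0 < margin (f 1) y0 y x0" "0 < margin (f 2) y0 y x0" if "y \<noteq> y0" for y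
    using smoothness_bound_pos[OF beta Delta(1) _ beta_le[OF that that]] by auto
  have "max_margin_ensemble 2 f (x0 + \<delta>) = y0"
  proof (rule max_margin_ensemble_2_eqI)
    fix y1 y2 assume y: "y1 \<noteq> y0" "y2 \<noteq> y0"
    \<comment> \<open>The explicit factors 1 are the weights of the max-margin case.\<close>
    have "0 < 1 * margin (f 1) y0 y1 (x0 + \<delta>) + 1 * margin (f 2) y0 y2 (x0 + \<delta>)"
    proof (rule combined_margin_pos[OF beta_smooth_margin_taylor[OF smooth] beta_smooth_margin_taylor[OF smooth]])
      have "C_MME f y0 x0 \<le> 2 * margin (f 1) y0 y1 x0 * margin (f 2) y0 y2 x0
          / (margin (f 1) y0 y1 x0 + margin (f 2) y0 y2 x0)\<^sup>2"
        unfolding C_MME_def using y by (intro Min_le) (auto intro!: image_eqI[of _ _ "(y1, y2)"])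
      then show "C_MME f y0 x0 \<le> 2 * 1 * 1 * margin (f 1) y0 y1 x0 * margin (f 2) y0 y2 x0
          / (1 * margin (f 1) y0 y1 x0 + 1 * margin (f 2) y0 y2 x0)\<^sup>2"
        by simp
      show "0 \<le> margin (f 1) y0 y1 (x0 + \<delta>)" "0 \<le> margin (f 2) y0 y2 (x0 + \<delta>)"
        if "norm \<delta> < r" for \<delta>
        using base_robust pos(2,3) that by (auto intro: robust_margin_nonneg)
    qed (use y pos smooth r beta Delta k \<kappa> c beta_le cos_le \<delta> in auto)
    then show "0 < margin (f 1) y0 y1 (x0 + \<delta>) + margin (f 2) y0 y2 (x0 + \<delta>)"
      by simp
  qed
  then show "max_margin_ensemble 2 f (x0 + \<delta>) = max_margin_ensemble 2 f x0"
    using pred0 by simp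
qed

theorem corollary1:
  fixes f :: "nat \<Rightarrow> real ^ 'd \<Rightarrow> real ^ 'c"
    and x0 :: "real ^ 'd" and y0 :: 'c
    and w :: "nat \<Rightarrow> real"
    and r \<beta> \<Delta> \<theta> :: real
  assumes confidence: "\<And>j x. j \<in> {1, 2} \<Longrightarrow> f j x \<in> prob_simplex"
    and smooth: "\<And>j. j \<in> {1, 2} \<Longrightarrow> beta_smooth \<beta> (f j)"
    and r_pos: "0 < r"
    and base_robust: "\<And>j. j \<in> {1, 2} \<Longrightarrow> robust (prediction (f j)) r x0"
    and Delta: "0 \<le> \<Delta>" "\<Delta> < 1"
    and theta: "0 \<le> cos \<theta>"
  shows
    "(let C = C_WE w f y0 x0;
          \<kappa> = (1 - \<Delta>) / (1 + \<Delta>) * (1 - C * (1 - cos \<theta>)) powr (-1/2);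
          c = max \<kappa> 1
      in 0 < w 1 \<and> 0 < w 2 \<longrightarrow>
         weighted_ensemble 2 w f x0 = y0 \<longrightarrow>
         (\<forall>y. y \<noteq> y0 \<longrightarrow>
            \<beta> \<le> \<Delta> * min (margin (f 1) y0 y x0) (margin (f 2) y0 y x0) / (c\<^sup>2 * r\<^sup>2) \<and>
            cos_angle (gradient (margin (f 1) y0 y) x0) (gradient (margin (f 2) y0 y) x0) \<le> cos \<theta>)
         \<longrightarrow> robust (weighted_ensemble 2 w f) (r * \<kappa>) x0)
     \<and>
     (let C = C_MME f y0 x0;
          \<kappa> = (1 - \<Delta>) / (1 + \<Delta>) * (1 - C * (1 - cos \<theta>)) powr (-1/2);
          c = max \<kappa> 1
      in max_margin_ensemble 2 f x0 = y0 \<longrightarrow>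
         (\<forall>y1 y2. y1 \<noteq> y0 \<longrightarrow> y2 \<noteq> y0 \<longrightarrow>
            \<beta> \<le> \<Delta> * min (margin (f 1) y0 y1 x0) (margin (f 2) y0 y2 x0) / (c\<^sup>2 * r\<^sup>2) \<and>
            cos_angle (gradient (margin (f 1) y0 y1) x0) (gradient (margin (f 2) y0 y2) x0) \<le> cos \<theta>)
         \<longrightarrow> robust (max_margin_ensemble 2 f) (r * \<kappa>) x0)"
proof (cases "\<beta> = 0")
  case True
  then have "f j x = f j y" if "j \<in> {1, 2}" for j x y
    using beta_smooth_zero_const[of "f j"] smooth confidence that by blast
  then show ?thesis
    using robust_weighted_ensemble_const[of f] robust_max_margin_ensemble_const[of f]
    by (simp add: Let_def)
next
  case False
  then have beta: "0 < \<beta>"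
    using beta_smooth_nonneg[OF smooth[of 1]] by simp
  show ?thesis
    unfolding Let_def
    \<comment> \<open>The two \<open>refl\<close> instantiate \<kappa> and \<open>c\<close> with the
      expressions bound by \<open>let\<close>.\<close>
    using robust_weighted_ensemble[of \<beta> f r x0 \<Delta> "cos \<theta>" _ w y0,
        OF smooth r_pos beta base_robust Delta theta cos_le_one refl refl]
      robust_max_margin_ensemble[of \<beta> f r x0 \<Delta> "cos \<theta>" _ y0,
        OF smooth r_pos beta base_robust Delta theta cos_le_one refl refl]
    by blast
qed

end
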